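(* For any Hausdorff space $X$, $$|X|\leq 2^{skL(X,2^{\psi(X)t(X)})\,\psi(X)\,t(X)}.$$
   Context: $\psi(X)$ is the pseudo-character and $t(X)$ the tightness of $X$ (cardinal functions are taken to be infinite). For a space $X$ and an infinite cardinal $\lambda$, the skew-$\lambda$ Lindelöf degree $skL(X,\lambda)$ is the least infinite cardinal $\kappa$ such that for every open cover $\mathcal{U}$ of $X$ there exists $\mathcal{V}\subseteq\mathcal{U}$ with $|\mathcal{V}|\leq\kappa$ and $|X\setminus\bigcup\mathcal{V}|<\lambda$. *)

theory Defs
  imports "HOL-Analysis.T1_Spaces"
begin

unbundle cardinal_syntax

text \<open>
  Since a set of cardinals has to live in one type, the cardinal functions of a space on points
  of type \<open>'a\<close> are taken as cardinals on the infinite type \<open>'a + nat\<close>, whose cardinality,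
  at least \<open>|X| + \<aleph>\<^sub>0\<close>, bounds all of them in a Hausdorff space. The lemmas
  ending in \<open>_le_iff\<close> show that nothing is lost: the resulting values are least among the infinite
  cardinals on arbitrary types.
\<close>

definition least_infinite_cardinal :: "('b rel \<Rightarrow> bool) \<Rightarrow> 'b rel" where
  "least_infinite_cardinal P =
    (SOME r. Cinfinite r \<and> P r \<and> (\<forall>s. Cinfinite s \<and> P s \<longrightarrow> r \<le>o s))"

text \<open>Meaningful only if such a family exists for some \<open>r\<close>, as it does at every point of a
  \<open>T\<^sub>1\<close> space.\<close>

definition pseudo_character_at :: "'a topology \<Rightarrow> 'a \<Rightarrow> ('a + nat) rel" where
  "pseudo_character_at X x = least_infinite_cardinal (\<lambda>r.
    \<exists>\<U>. \<U> \<subseteq> {U. openin X U} \<and> |\<U>| \<le>o r \<and> \<Inter>\<U> = {x})"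

text \<open>The least infinite cardinal above all values at points is their supremum plus \<open>\<aleph>\<^sub>0\<close>.\<close>

definition pseudo_character :: "'a topology \<Rightarrow> ('a + nat) rel" where
  "pseudo_character X = least_infinite_cardinal (\<lambda>r.
    \<forall>x\<in>topspace X. pseudo_character_at X x \<le>o r)"

definition tightness_at :: "'a topology \<Rightarrow> 'a \<Rightarrow> ('a + nat) rel" where
  "tightness_at X x = least_infinite_cardinal (\<lambda>r.
    \<forall>A. A \<subseteq> topspace X \<and> x \<in> X closure_of A \<longrightarrow>
      (\<exists>B. B \<subseteq> A \<and> |B| \<le>o r \<and> x \<in> X closure_of B))"

definition tightness :: "'a topology \<Rightarrow> ('a + nat) rel" where
  "tightness X = least_infinite_cardinal (\<lambda>r.
    \<forall>x\<in>topspace X. tightness_at X x \<le>o r)"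

definition skew_Lindelof_degree :: "'a topology \<Rightarrow> 'l rel \<Rightarrow> ('a + nat) rel" where
  "skew_Lindelof_degree X l = least_infinite_cardinal (\<lambda>r.
    \<forall>\<U>. \<U> \<subseteq> {U. openin X U} \<and> \<Union>\<U> = topspace X \<longrightarrow>
      (\<exists>\<V>. \<V> \<subseteq> \<U> \<and> |\<V>| \<le>o r \<and> |topspace X - \<Union>\<V>| <o l))"

lemma least_infinite_cardinal_ex:
  assumes "\<exists>r. Cinfinite r \<and> P r"
  shows "Cinfinite (least_infinite_cardinal P) \<and> P (least_infinite_cardinal P) \<and>
    (\<forall>s. Cinfinite s \<and> P s \<longrightarrow> least_infinite_cardinal P \<le>o s)"
proof -
  let ?R = "{r. Cinfinite r \<and> P r}"
  have "?R \<noteq> {}" "\<forall>r\<in>?R. Card_order r" using assms by auto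
  then obtain r where "r \<in> ?R" "\<forall>s\<in>?R. r \<le>o s"
    using exists_minim_Card_order[of ?R] by blast
  then have "\<exists>r. Cinfinite r \<and> P r \<and> (\<forall>s. Cinfinite s \<and> P s \<longrightarrow> r \<le>o s)" by blast
  then show ?thesis unfolding least_infinite_cardinal_def by (rule someI_ex)
qed

lemma least_infinite_cardinal_le_iff:
  fixes P :: "'b rel \<Rightarrow> bool" and r :: "'c rel"
  assumes inf: "infinite (UNIV :: 'b set)" and top: "P |UNIV|"
    and up: "\<And>s. P s \<Longrightarrow> s \<le>o r \<Longrightarrow> Q r"
    and down: "\<And>s. Q r \<Longrightarrow> r \<le>o s \<Longrightarrow> P s"
    and r: "Cinfinite r"
  shows "least_infinite_cardinal P \<le>o r \<longleftrightarrow> Q r"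
proof -
  have topinf: "Cinfinite ( |UNIV :: 'b set| )"
    using inf by (simp add: cinfinite_def Field_card_of card_of_card_order_on)
  have L: "P (least_infinite_cardinal P)"
    "\<And>s. Cinfinite s \<Longrightarrow> P s \<Longrightarrow> least_infinite_cardinal P \<le>o s"
    using least_infinite_cardinal_ex[of P] topinf top by blast+
  show ?thesis
  proof
    assume "least_infinite_cardinal P \<le>o r"
    with L(1) show "Q r" by (rule up)
  next
    assume q: "Q r"
    show "least_infinite_cardinal P \<le>o r"
    proof (cases "r \<le>o |UNIV :: 'b set|")
      case True
      have F: "|Field r| =o r" using r by (simp add: card_of_Field_ordIso)
      have "|Field r| \<le>o |UNIV :: 'b set|" using F True by (rule ordIso_ordLeq_trans)
      then obtain B :: "'b set" where "|Field r| =o |B|"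
        using iffD1[OF internalize_card_of_ordLeq2] by blast
      then have B: "r =o |B|" by (rule ordIso_transitive[OF ordIso_symmetric[OF F]])
      have "Cinfinite |B|" using Cinfinite_cong[OF B r] .
      moreover have "P |B|" using q ordIso_imp_ordLeq[OF B] by (rule down)
      ultimately have "least_infinite_cardinal P \<le>o |B|" by (rule L(2))
      then show ?thesis using ordIso_symmetric[OF B] by (rule ordLeq_ordIso_trans)
    next
      case False
      then have "|UNIV :: 'b set| \<le>o r"
        using r ordLeq_total[OF card_of_Well_order card_order_on_well_order_on] by blast
      with L(2)[OF topinf top] show ?thesis by (rule ordLeq_transitive)
    qed
  qed
qed

lemma card_of_point_le_top: "|A :: 'a set| \<le>o |UNIV :: ('a + nat) set|"
  using card_of_ordLeqI[of Inl A "UNIV :: ('a + nat) set"] by simp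

lemma ex_card_le_mono:
  assumes "\<exists>B. P B \<and> |B| \<le>o s \<and> R B" "s \<le>o r"
  shows "\<exists>B. P B \<and> |B| \<le>o r \<and> R B"
proof -
  from assms(1) obtain B where B: "P B" "|B| \<le>o s" "R B" by blast
  have "|B| \<le>o r" using B(2) assms(2) by (rule ordLeq_transitive)
  with B show ?thesis by blast
qed

lemma infinite_UNIV_point: "infinite (UNIV :: ('a + nat) set)"
  by (simp add: finite_Plus_UNIV_iff)

lemma Cinfinite_UNIV_point: "Cinfinite |UNIV :: ('a + nat) set|"
  using infinite_UNIV_point
  by (simp add: cinfinite_def Field_card_of card_of_card_order_on)

lemma pseudo_base_ex:
  fixes X :: "'a topology"
  assumes X: "t1_space X" and x: "x \<in> topspace X"
  shows "\<exists>\<U>. \<U> \<subseteq> {U. openin X U} \<and> |\<U>| \<le>o |UNIV :: ('a + nat) set| \<and> \<Inter>\<U> = {x}"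
proof -
  let ?f = "\<lambda>y. if y = x then topspace X else topspace X - {y}"
  let ?U = "?f ` topspace X"
  have "?U \<subseteq> {U. openin X U}"
    using X by (auto simp: t1_space_openin_delete_alt)
  moreover have "\<Inter>?U = {x}"
  proof
    show "\<Inter>?U \<subseteq> {x}"
    proof
      fix z assume z: "z \<in> \<Inter>?U"
      then have "z \<in> ?f x" using x by blast
      then have "z \<in> topspace X" by simp
      then have "z \<in> ?f z" using z by blast
      then show "z \<in> {x}" by (cases "z = x") simp_all
    qed
    show "{x} \<subseteq> \<Inter>?U" using x by simp
  qed
  moreover have "|?U| \<le>o |UNIV :: ('a + nat) set|"
    by (rule ordLeq_transitive[OF card_of_image card_of_point_le_top])
  ultimately show ?thesis by blast
qed

lemma pseudo_character_at_le_iff: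
  fixes X :: "'a topology" and r :: "'c rel"
  assumes X: "t1_space X" and x: "x \<in> topspace X" and r: "Cinfinite r"
  shows "pseudo_character_at X x \<le>o r \<longleftrightarrow>
    (\<exists>\<U>. \<U> \<subseteq> {U. openin X U} \<and> |\<U>| \<le>o r \<and> \<Inter>\<U> = {x})"
  unfolding pseudo_character_at_def
  by (rule least_infinite_cardinal_le_iff[OF infinite_UNIV_point _ _ _ r],
      rule pseudo_base_ex[OF X x]) (erule (1) ex_card_le_mono)+

lemma tightness_at_le_iff:
  fixes X :: "'a topology" and r :: "'c rel"
  assumes r: "Cinfinite r"
  shows "tightness_at X x \<le>o r \<longleftrightarrow>
    (\<forall>A. A \<subseteq> topspace X \<and> x \<in> X closure_of A \<longrightarrow>
      (\<exists>B. B \<subseteq> A \<and> |B| \<le>o r \<and> x \<in> X closure_of B))"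
  unfolding tightness_at_def
proof (rule least_infinite_cardinal_le_iff[OF infinite_UNIV_point _ _ _ r])
  show "\<forall>A. A \<subseteq> topspace X \<and> x \<in> X closure_of A \<longrightarrow>
      (\<exists>B. B \<subseteq> A \<and> |B| \<le>o |UNIV :: ('a + nat) set| \<and> x \<in> X closure_of B)"
    by (intro allI impI, rule exI, intro conjI, rule subset_refl, rule card_of_point_le_top)
      (elim conjE)
qed (rule allI, rule impI, drule spec, drule (1) mp, erule (1) ex_card_le_mono)+

lemma pseudo_character_le_iff:
  fixes X :: "'a topology" and r :: "'c rel"
  assumes X: "t1_space X" and r: "Cinfinite r"
  shows "pseudo_character X \<le>o r \<longleftrightarrow> (\<forall>x\<in>topspace X.
    \<exists>\<U>. \<U> \<subseteq> {U. openin X U} \<and> |\<U>| \<le>o r \<and> \<Inter>\<U> = {x})"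
proof -
  have "pseudo_character X \<le>o r \<longleftrightarrow> (\<forall>x\<in>topspace X. pseudo_character_at X x \<le>o r)"
    unfolding pseudo_character_def
  proof (rule least_infinite_cardinal_le_iff[OF infinite_UNIV_point _ _ _ r])
    show "\<forall>x\<in>topspace X. pseudo_character_at X x \<le>o |UNIV :: ('a + nat) set|"
      by (rule ballI, rule iffD2[OF pseudo_character_at_le_iff[OF X _ Cinfinite_UNIV_point]])
        (assumption, erule pseudo_base_ex[OF X])
  qed (rule ballI, drule (1) bspec, erule (1) ordLeq_transitive)+
  then show ?thesis by (simp add: pseudo_character_at_le_iff[OF X _ r])
qed

lemma tightness_le_iff:
  fixes X :: "'a topology" and r :: "'c rel"
  assumes r: "Cinfinite r"
  shows "tightness X \<le>o r \<longleftrightarrow>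
    (\<forall>x\<in>topspace X. \<forall>A. A \<subseteq> topspace X \<and> x \<in> X closure_of A \<longrightarrow>
      (\<exists>B. B \<subseteq> A \<and> |B| \<le>o r \<and> x \<in> X closure_of B))"
proof -
  have "tightness X \<le>o r \<longleftrightarrow> (\<forall>x\<in>topspace X. tightness_at X x \<le>o r)"
    unfolding tightness_def
  proof (rule least_infinite_cardinal_le_iff[OF infinite_UNIV_point _ _ _ r])
    show "\<forall>x\<in>topspace X. tightness_at X x \<le>o |UNIV :: ('a + nat) set|"
      unfolding tightness_at_le_iff[OF Cinfinite_UNIV_point]
      by (intro ballI allI impI, rule exI, intro conjI, rule subset_refl,
          rule card_of_point_le_top) (elim conjE)
  qed (rule ballI, drule (1) bspec, erule (1) ordLeq_transitive)+
  then show ?thesis by (simp add: tightness_at_le_iff[OF r])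
qed

lemma skew_Lindelof_degree_le_iff:
  fixes X :: "'a topology" and l :: "'l rel" and r :: "'c rel"
  assumes l: "Cinfinite l" and r: "Cinfinite r"
  shows "skew_Lindelof_degree X l \<le>o r \<longleftrightarrow>
    (\<forall>\<U>. \<U> \<subseteq> {U. openin X U} \<and> \<Union>\<U> = topspace X \<longrightarrow>
      (\<exists>\<V>. \<V> \<subseteq> \<U> \<and> |\<V>| \<le>o r \<and> |topspace X - \<Union>\<V>| <o l))"
  unfolding skew_Lindelof_degree_def
proof (rule least_infinite_cardinal_le_iff[OF infinite_UNIV_point _ _ _ r])
  show "\<forall>\<U>. \<U> \<subseteq> {U. openin X U} \<and> \<Union>\<U> = topspace X \<longrightarrow>
      (\<exists>\<V>. \<V> \<subseteq> \<U> \<and> |\<V>| \<le>o |UNIV :: ('a + nat) set| \<and>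
        |topspace X - \<Union>\<V>| <o l)"
  proof (intro allI impI)
    fix \<U> assume U: "\<U> \<subseteq> {U. openin X U} \<and> \<Union>\<U> = topspace X"
    then have "\<forall>x\<in>topspace X. \<exists>V\<in>\<U>. x \<in> V" by blast
    then obtain f where f: "\<forall>x\<in>topspace X. f x \<in> \<U> \<and> x \<in> f x" by metis
    let ?V = "f ` topspace X"
    have "topspace X - \<Union>?V = {}" using f by blast
    moreover have "|{} :: 'a set| <o l"
    proof (rule finite_ordLess_infinite)
      show "Well_order |{} :: 'a set|" by (rule card_of_Well_order)
      show "Well_order l" using l card_order_on_well_order_on by blast
      show "finite (Field |{} :: 'a set| )" by (simp add: Field_card_of)
      show "infinite (Field l)" using l by (simp add: cinfinite_def)
    qed
    moreover have "|?V| \<le>o |UNIV :: ('a + nat) set|"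
      by (rule ordLeq_transitive[OF card_of_image card_of_point_le_top])
    moreover have "?V \<subseteq> \<U>" using f by blast
    ultimately show "\<exists>\<V>. \<V> \<subseteq> \<U> \<and> |\<V>| \<le>o |UNIV :: ('a + nat) set| \<and>
        |topspace X - \<Union>\<V>| <o l"
      by (intro exI[of _ ?V]) (simp only:)
  qed
qed (rule allI, rule impI, drule spec, drule (1) mp, erule (1) ex_card_le_mono)+

end

theory Submission
  imports Defs
begin

text \<open>
  Let \<open>\<kappa>\<close> be the cardinal in the exponent and \<open>\<lambda> = 2\<close> to the power \<open>\<psi>(X) t(X)\<close>, so that
  \<open>\<lambda> \<le> 2\<^sup>\<kappa>\<close>. The proof adapts the closing-off argument for the bound of \<open>|X|\<close> by the Lindelof
  degree, pseudo-character and tightness. In that argument a set \<open>F\<close> of size at most \<open>2\<^sup>\<kappa>\<close> is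
  built that is closed in \<open>X\<close> and picks up a point outside \<open>\<Union>\<V>\<close> whenever \<open>\<V>\<close> consists of at
  most \<open>\<kappa>\<close> basic sets chosen at points of \<open>F\<close> and does not cover \<open>X\<close>; a point outside \<open>F\<close>
  would yield such a \<open>\<V>\<close> that covers \<open>F\<close> but misses that point, which is absurd. Here the
  small subfamilies of covers may miss fewer than \<open>\<lambda>\<close> points, and this has to be absorbed twice.

  First, small sets must have small closures. In a Hausdorff space of Lindelof degree and
  pseudo-character at most \<open>\<kappa>\<close> every point is the intersection of the closures of at most \<open>\<kappa>\<close>
  of its neighbourhoods. Now that intersection can have more points,
  but it still has size at most \<open>2\<^sup>\<kappa>\<close> (\<open>small_intersection_of_closures\<close>). A point \<open>x\<close> in
  the closure of \<open>A\<close> is determined, up to such an intersection, by the traces on \<open>A\<close> of these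
  neighbourhoods, and a set \<open>A\<close> of size at most \<open>\<kappa>\<close> has only \<open>2\<^sup>\<kappa>\<close> families of at most
  \<open>\<kappa>\<close> traces (\<open>card_closure_le\<close>).

  Second, for a family \<open>\<V>\<close> as above one point outside \<open>\<Union>\<V>\<close> is not enough, since \<open>\<V>\<close> may
  miss points of \<open>F\<close>. So \<open>F\<close> is made to contain all of \<open>X - \<Union>\<V>\<close> if that set has fewer
  than \<open>\<lambda>\<close> points, and \<open>\<lambda>\<close> of its points otherwise. If \<open>\<V>\<close> covers \<open>F\<close> except for fewer than
  \<open>\<lambda>\<close> points, the second case is excluded, so \<open>X - \<Union>\<V>\<close> lies in \<open>F\<close>; but a point outside
  \<open>F\<close> that all members of \<open>\<V>\<close> avoid belongs to \<open>X - \<Union>\<V>\<close>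
  (\<open>Hausdorff_card_le_ctwo_cexp\<close>).
\<close>

section \<open>Cardinal arithmetic below a power of two\<close>

lemma card_of_subset_le: "A \<subseteq> B \<Longrightarrow> |B| \<le>o r \<Longrightarrow> |A| \<le>o r"
  by (rule ordLeq_transitive[OF card_of_mono1])

lemma card_of_image_le: "|A| \<le>o r \<Longrightarrow> |f ` A| \<le>o r"
  by (rule ordLeq_transitive[OF card_of_image])

lemma card_of_finite_less:
  assumes "finite A" "Cinfinite r"
  shows "|A| <o r"
proof (rule finite_ordLess_infinite)
  show "Well_order |A|" by (rule card_of_Well_order)
  show "Well_order r" using assms(2) card_order_on_well_order_on by blast
  show "finite (Field |A| )" using assms(1) by (simp add: Field_card_of)
  show "infinite (Field r)" using assms(2) by (simp add: cinfinite_def)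
qed

lemma Cinfinite_ctwo_cexp: "Cinfinite k \<Longrightarrow> Cinfinite (ctwo ^c k)"
  by (rule Cinfinite_cexp[OF ordLeq_refl[OF Card_order_ctwo]])

lemma ordLeq_cprod1: "Card_order p \<Longrightarrow> Cnotzero q \<Longrightarrow> p \<le>o p *c q"
  by (rule ordLeq_ordIso_trans[OF ordLeq_cprod2 cprod_com])

text \<open>A nonempty subset of size at most \<open>k\<close> is the image of a map from \<open>k\<close>, and
  \<open>(2\<^sup>k)\<^sup>k = 2\<^sup>k\<close>.\<close>

lemma card_bounded_subsets_le:
  fixes S :: "'a set" and k :: "'k rel"
  assumes k: "Cinfinite k" and S: "|S| \<le>o ctwo ^c k"
  shows "|{B. B \<subseteq> S \<and> |B| \<le>o k}| \<le>o ctwo ^c k"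
proof -
  have K: "Card_order k" "Field k \<noteq> {}" using k by (auto simp: cinfinite_def)
  have inf2: "Cinfinite (ctwo ^c k)" by (rule Cinfinite_ctwo_cexp[OF k])
  have sub: "{B. B \<subseteq> S \<and> |B| \<le>o k} \<subseteq> (\<lambda>f. f ` Field k) ` Func (Field k) S \<union> {{}}"
  proof
    fix B assume B: "B \<in> {B. B \<subseteq> S \<and> |B| \<le>o k}"
    show "B \<in> (\<lambda>f. f ` Field k) ` Func (Field k) S \<union> {{}}"
    proof (cases "B = {}")
      case False
      have "|B| \<le>o |Field k|"
        by (rule ordLeq_ordIso_trans[OF _ ordIso_symmetric[OF card_of_Field_ordIso[OF K(1)]]])
          (use B in simp)
      with False obtain g where g: "g ` Field k = B"
        using card_of_ordLeq2[of B "Field k"] by blast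
      let ?h = "\<lambda>i. if i \<in> Field k then g i else undefined"
      have "?h \<in> Func (Field k) S" using g B by (auto simp: Func_def)
      moreover have "B = ?h ` Field k" using g by auto
      ultimately show ?thesis by blast
    qed simp
  qed
  have "|Func (Field k) S| =o |S| ^c k"
    unfolding cexp_def Field_card_of by (rule card_of_refl)
  also have "|S| ^c k \<le>o (ctwo ^c k) ^c k" by (rule cexp_mono1[OF S K(1)])
  also have "(ctwo ^c k) ^c k =o ctwo ^c k"
    by (rule cexp_cprod_ordLeq[OF Card_order_ctwo k Cinfinite_Cnotzero[OF k] ordLeq_refl[OF K(1)]])
  finally have "|(\<lambda>f. f ` Field k) ` Func (Field k) S| \<le>o ctwo ^c k"
    by (rule card_of_image_le)
  moreover have "|{{}} :: 'a set set| \<le>o ctwo ^c k"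
    by (rule ordLess_imp_ordLeq[OF card_of_finite_less[OF _ inf2]]) simp
  ultimately have "|(\<lambda>f. f ` Field k) ` Func (Field k) S \<union> {{}}| \<le>o ctwo ^c k"
    by (rule Un_Cinfinite_bound[OF _ _ inf2])
  then show ?thesis by (rule card_of_subset_le[OF sub])
qed

text \<open>The operation is iterated along the successor cardinal \<open>k\<^sup>+ \<le> 2\<^sup>k\<close>. Each stage stays of
  size at most \<open>2\<^sup>k\<close>, since a set of that size has only \<open>2\<^sup>k\<close> subsets of size at most \<open>k\<close>. As \<open>k\<^sup>+\<close> is
  regular, every small subset of the union already lies in some stage, and the next stage contains
  its image.\<close>

lemma closing_off:
  fixes \<phi> :: "'a set \<Rightarrow> 'a set" and k :: "'k rel"
  assumes k: "Cinfinite k"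
    and \<phi>: "\<And>B. B \<subseteq> T \<Longrightarrow> |B| \<le>o k \<Longrightarrow> \<phi> B \<subseteq> T \<and> |\<phi> B| \<le>o ctwo ^c k"
  shows "\<exists>F. F \<subseteq> T \<and> |F| \<le>o ctwo ^c k \<and> (\<forall>B. B \<subseteq> F \<longrightarrow> |B| \<le>o k \<longrightarrow> \<phi> B \<subseteq> F)"
proof -
  let ?s = "cardSuc k"
  define \<Phi> where "\<Phi> S = S \<union> \<Union>(\<phi> ` {B. B \<subseteq> S \<and> |B| \<le>o k})" for S
  define G where "G = wfrec (?s - Id) (\<lambda>G i. \<Phi> (\<Union>j\<in>underS ?s i. G j))"
  have K: "Card_order k" using k by blast
  have inf2: "Cinfinite (ctwo ^c k)" by (rule Cinfinite_ctwo_cexp[OF k])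
  have s: "Card_order ?s" by (rule cardSuc_Card_order[OF K])
  have wf: "wf (?s - Id)"
    using cardSuc_Well_order[OF K] by (simp add: well_order_on_def)
  have s_le: "?s \<le>o ctwo ^c k"
    using cardSuc_ordLess_ordLeq[OF K Card_order_cexp] ordLess_ctwo_cexp[OF K] by blast
  have Field_le: "|Field ?s| \<le>o ctwo ^c k"
    by (rule ordIso_ordLeq_trans[OF card_of_Field_ordIso[OF s] s_le])
  have G: "G i = \<Phi> (\<Union>j\<in>underS ?s i. G j)" for i
  proof -
    have "G i = \<Phi> (\<Union>j\<in>underS ?s i. cut G (?s - Id) i j)"
      unfolding G_def by (subst wfrec[OF wf]) simp
    also have "(\<Union>j\<in>underS ?s i. cut G (?s - Id) i j) = (\<Union>j\<in>underS ?s i. G j)"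
      by (auto simp: cut_def underS_def)
    finally show ?thesis .
  qed
  have chain: "relChain ?s G"
    unfolding relChain_def
  proof (intro allI impI)
    fix i j assume ij: "(i, j) \<in> ?s"
    show "G i \<subseteq> G j"
    proof (cases "i = j")
      case False
      then have "i \<in> underS ?s j" using ij by (simp add: underS_def)
      then show ?thesis by (subst (2) G) (auto simp: \<Phi>_def)
    qed simp
  qed
  have bound: "G i \<subseteq> T \<and> |G i| \<le>o ctwo ^c k" for i
    using wf
  proof (induction i)
    case (less i)
    let ?S = "\<Union>j\<in>underS ?s i. G j"
    have ih: "G j \<subseteq> T \<and> |G j| \<le>o ctwo ^c k" if "j \<in> underS ?s i" for j
      using that less by (simp add: underS_def)
    have "underS ?s i \<subseteq> Field ?s" by (auto simp: underS_def Field_def)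
    then have "|underS ?s i| \<le>o ctwo ^c k" by (rule card_of_subset_le[OF _ Field_le])
    then have S: "|?S| \<le>o ctwo ^c k"
      by (rule UNION_Cinfinite_bound[OF _ _ inf2]) (simp add: ih)
    have ST: "?S \<subseteq> T" using ih by blast
    have "|\<Union>(\<phi> ` {B. B \<subseteq> ?S \<and> |B| \<le>o k})| \<le>o ctwo ^c k"
      by (rule UNION_Cinfinite_bound[OF card_bounded_subsets_le[OF k S] _ inf2])
        (simp add: \<phi> subset_trans[OF _ ST])
    then have "|\<Phi> ?S| \<le>o ctwo ^c k"
      unfolding \<Phi>_def by (rule Un_Cinfinite_bound[OF S _ inf2])
    moreover have "\<Phi> ?S \<subseteq> T"
      unfolding \<Phi>_def using ST \<phi> subset_trans[OF _ ST]
      by (intro Un_least UN_least) (simp_all add: ih)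
    ultimately show ?case unfolding G[of i] by (intro conjI)
  qed
  let ?F = "\<Union>i\<in>Field ?s. G i"
  show ?thesis
  proof (intro exI[of _ ?F] conjI allI impI)
    show "?F \<subseteq> T" using bound by blast
    show "|?F| \<le>o ctwo ^c k"
      by (rule UNION_Cinfinite_bound[OF Field_le _ inf2]) (simp add: bound)
    fix B assume B: "B \<subseteq> ?F" "|B| \<le>o k"
    then obtain i where i: "i \<in> Field ?s" "B \<subseteq> G i"
      using cardSuc_UNION_Cinfinite[OF k chain B] by blast
    \<comment> \<open>\<open>k\<^sup>+\<close> is a limit ordinal, so there is a stage after the one that contains \<open>B\<close>.\<close>
    have "infinite (Field ?s)" using Cinfinite_cardSuc[OF k] by (simp add: cinfinite_def)
    then obtain j where j: "j \<in> Field ?s" "i \<in> underS ?s j"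
      using infinite_Card_order_limit[OF s _ i(1)] by (auto simp: underS_def)
    then have "B \<subseteq> (\<Union>j\<in>underS ?s j. G j)" using i by blast
    then have "\<phi> B \<subseteq> G j" using B(2) by (subst G) (auto simp: \<Phi>_def)
    with j show "\<phi> B \<subseteq> ?F" by blast
  qed
qed

section \<open>Closures of small sets\<close>

text \<open>For each member \<open>U\<close> of the pseudo-base at \<open>x\<close>, the space is covered by \<open>U\<close> and the open
  sets \<open>V\<close> whose closure avoids \<open>x\<close>. The neighbourhoods are the complements of the closures of
  those \<open>V\<close> that occur in the small subfamilies. A point \<open>z \<noteq> x\<close> is outside some \<open>U\<close>, and if it
  lies in a chosen \<open>V\<close> then \<open>V\<close> separates it from the neighbourhood given by \<open>V\<close>. So besides
  \<open>x\<close> only the points missed by one of the subfamilies survive: at most \<open>k\<close> times fewer than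
  \<open>l\<close>.\<close>

lemma small_intersection_of_closures:
  fixes X :: "'a topology" and k :: "'k rel" and l :: "'l rel"
  assumes X: "Hausdorff_space X" and k: "Cinfinite k" and l: "l \<le>o ctwo ^c k"
    and x: "x \<in> topspace X"
    and \<U>: "\<U> \<subseteq> {U. openin X U}" "|\<U>| \<le>o k" "\<Inter>\<U> = {x}"
    and cover: "\<And>\<C>. \<C> \<subseteq> {U. openin X U} \<Longrightarrow> \<Union>\<C> = topspace X \<Longrightarrow>
      \<exists>\<V>. \<V> \<subseteq> \<C> \<and> |\<V>| \<le>o k \<and> |topspace X - \<Union>\<V>| <o l"
  shows "\<exists>\<N>. \<N> \<subseteq> {W. openin X W \<and> x \<in> W} \<and> |\<N>| \<le>o k \<and>
    |{z \<in> topspace X. \<forall>W\<in>\<N>. z \<in> X closure_of W}| \<le>o ctwo ^c k"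
proof -
  have K: "Card_order k" using k by blast
  have inf2: "Cinfinite (ctwo ^c k)" by (rule Cinfinite_ctwo_cexp[OF k])
  let ?O = "{V. openin X V \<and> x \<notin> X closure_of V}"
  have "\<forall>U\<in>\<U>. \<exists>\<V>. \<V> \<subseteq> insert U ?O \<and> |\<V>| \<le>o k \<and> |topspace X - \<Union>\<V>| <o l"
  proof (intro ballI cover)
    fix U assume U: "U \<in> \<U>"
    show "insert U ?O \<subseteq> {U. openin X U}" using U \<U>(1) by blast
    have "y \<in> \<Union>(insert U ?O)" if y: "y \<in> topspace X" for y
    proof (cases "y = x")
      case True
      then show ?thesis using \<U>(3) U by blast
    next
      case False
      then obtain W V where "openin X W" "openin X V" "x \<in> W" "y \<in> V" "disjnt W V"
        using X x y unfolding Hausdorff_space_def by metis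
      then have "V \<in> ?O" "y \<in> V" by (auto simp: in_closure_of disjnt_iff)
      then show ?thesis by blast
    qed
    then show "\<Union>(insert U ?O) = topspace X"
      using U \<U>(1) openin_subset by blast
  qed
  from bchoice[OF this] obtain v where "\<forall>U\<in>\<U>.
      v U \<subseteq> insert U ?O \<and> |v U| \<le>o k \<and> |topspace X - \<Union>(v U)| <o l"
    by (rule exE)
  note v = bspec[OF this]
  let ?N = "(\<lambda>V. topspace X - X closure_of V) ` (\<Union>U\<in>\<U>. v U \<inter> ?O)"
  let ?Z = "{z \<in> topspace X. \<forall>W\<in>?N. z \<in> X closure_of W}"
  have "?N \<subseteq> {W. openin X W \<and> x \<in> W}" using x by auto
  moreover have "|?N| \<le>o k"
  proof -
    have "|v U \<inter> ?O| \<le>o k" if "U \<in> \<U>" for U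
      by (rule card_of_subset_le[of _ "v U"]) (simp_all add: v[OF that])
    then have "|\<Union>U\<in>\<U>. v U \<inter> ?O| \<le>o k"
      by (intro UNION_Cinfinite_bound[OF \<U>(2) _ k]) simp
    then show ?thesis by (rule card_of_image_le)
  qed
  moreover have "|?Z| \<le>o ctwo ^c k"
  proof -
    have sub: "?Z \<subseteq> {x} \<union> (\<Union>U\<in>\<U>. topspace X - \<Union>(v U))"
    proof
      fix z assume z: "z \<in> ?Z"
      show "z \<in> {x} \<union> (\<Union>U\<in>\<U>. topspace X - \<Union>(v U))"
      proof (cases "z = x")
        case False
        then obtain U where U: "U \<in> \<U>" "z \<notin> U" using \<U>(3) by blast
        have "z \<notin> V" if V: "V \<in> v U" for V
        proof
          assume zV: "z \<in> V"
          then have VO: "V \<in> ?O" using V v[OF U(1)] U(2) by blast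
          then have "z \<in> X closure_of (topspace X - X closure_of V)" using z V U by blast
          then obtain w where "w \<in> topspace X - X closure_of V" "w \<in> V"
            using zV VO unfolding in_closure_of by blast
          then show False using VO closure_of_subset[OF openin_subset, of X V] by blast
        qed
        then show ?thesis using U z by blast
      qed simp
    qed
    have "|topspace X - \<Union>(v U)| \<le>o ctwo ^c k" if "U \<in> \<U>" for U
      by (rule ordLeq_transitive[OF ordLess_imp_ordLeq l]) (simp add: v[OF that])
    moreover have "|\<U>| \<le>o ctwo ^c k"
      using \<U>(2) ordLess_imp_ordLeq[OF ordLess_ctwo_cexp[OF K]] by (rule ordLeq_transitive)
    ultimately have 1: "|\<Union>U\<in>\<U>. topspace X - \<Union>(v U)| \<le>o ctwo ^c k"
      by (intro UNION_Cinfinite_bound[OF _ _ inf2]) simp_all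
    have 2: "|{x}| \<le>o ctwo ^c k"
      by (rule ordLess_imp_ordLeq[OF card_of_finite_less[OF _ inf2]]) simp
    show ?thesis
      by (rule card_of_subset_le[OF sub Un_Cinfinite_bound[OF 2 1 inf2]])
  qed
  ultimately show ?thesis by blast
qed

text \<open>The map that sends \<open>x\<close> to the traces on \<open>A\<close> of its chosen neighbourhoods takes at most
  \<open>2\<^sup>k\<close> values. Its fibres have size at most \<open>2\<^sup>k\<close>: a point of the closure of \<open>A\<close> lies in the
  closure of each of its traces, so a point with the same traces as \<open>x\<close> lies in the closure of
  every chosen neighbourhood of \<open>x\<close>.\<close>

lemma card_closure_le:
  fixes X :: "'a topology" and k :: "'k rel"
  assumes k: "Cinfinite k" and A: "|A| \<le>o k"
    and \<N>: "\<And>x. x \<in> topspace X \<Longrightarrow> \<exists>\<N>. \<N> \<subseteq> {W. openin X W \<and> x \<in> W} \<and> |\<N>| \<le>o k \<and>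
      |{z \<in> topspace X. \<forall>W\<in>\<N>. z \<in> X closure_of W}| \<le>o ctwo ^c k"
  shows "|X closure_of A| \<le>o ctwo ^c k"
proof -
  have K: "Card_order k" using k by blast
  have inf2: "Cinfinite (ctwo ^c k)" by (rule Cinfinite_ctwo_cexp[OF k])
  have k_le: "k \<le>o ctwo ^c k" by (rule ordLess_imp_ordLeq[OF ordLess_ctwo_cexp[OF K]])
  from bchoice[OF ballI, OF \<N>] obtain N where "\<forall>x\<in>topspace X.
      N x \<subseteq> {W. openin X W \<and> x \<in> W} \<and> |N x| \<le>o k \<and>
      |{z \<in> topspace X. \<forall>W\<in>N x. z \<in> X closure_of W}| \<le>o ctwo ^c k"
    by (rule exE)
  note N = bspec[OF this]
  define g where "g x = (\<lambda>W. A \<inter> W) ` N x" for x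
  let ?C = "X closure_of A"
  have top: "x \<in> topspace X" if "x \<in> ?C" for x using that by (simp add: in_closure_of)
  have trace: "x \<in> X closure_of (A \<inter> W)" if x: "x \<in> ?C" and W: "W \<in> N x" for x W
    unfolding in_closure_of
  proof (intro conjI allI impI)
    show "x \<in> topspace X" by (rule top[OF x])
    fix T assume "x \<in> T \<and> openin X T"
    then have "x \<in> T \<inter> W \<and> openin X (T \<inter> W)" using N[OF top[OF x]] W by auto
    then show "\<exists>y. y \<in> A \<inter> W \<and> y \<in> T" using x unfolding in_closure_of by blast
  qed
  have fibre: "|{y \<in> ?C. g y = g x}| \<le>o ctwo ^c k" if x: "x \<in> ?C" for x
  proof -
    have "{y \<in> ?C. g y = g x} \<subseteq> {z \<in> topspace X. \<forall>W\<in>N x. z \<in> X closure_of W}"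
    proof
      fix y assume y: "y \<in> {y \<in> ?C. g y = g x}"
      have "y \<in> X closure_of W" if "W \<in> N x" for W
      proof -
        have "A \<inter> W \<in> g y" using y that by (auto simp: g_def)
        then obtain W' where "W' \<in> N y" "A \<inter> W' = A \<inter> W" by (auto simp: g_def)
        then have "y \<in> X closure_of (A \<inter> W)" using trace[of y W'] y by simp
        then show ?thesis using closure_of_mono[of "A \<inter> W" W X] by blast
      qed
      then show "y \<in> {z \<in> topspace X. \<forall>W\<in>N x. z \<in> X closure_of W}" using y top by blast
    qed
    then show ?thesis by (rule card_of_subset_le) (simp add: N[OF top[OF x]])
  qed
  have "|Pow A| \<le>o ctwo ^c k"
  proof -
    have "Pow A = {B. B \<subseteq> A \<and> |B| \<le>o k}"
      using card_of_subset_le[OF _ A] by auto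
    then show ?thesis
      using card_bounded_subsets_le[OF k ordLeq_transitive[OF A k_le]] by simp
  qed
  then have "|{\<A>. \<A> \<subseteq> Pow A \<and> |\<A>| \<le>o k}| \<le>o ctwo ^c k"
    by (rule card_bounded_subsets_le[OF k])
  moreover have "g ` ?C \<subseteq> {\<A>. \<A> \<subseteq> Pow A \<and> |\<A>| \<le>o k}"
  proof
    fix c assume "c \<in> g ` ?C"
    then obtain x where x: "x \<in> ?C" "c = g x" by blast
    have "|g x| \<le>o k" unfolding g_def by (rule card_of_image_le) (simp add: N[OF top[OF x(1)]])
    moreover have "g x \<subseteq> Pow A" by (auto simp: g_def)
    ultimately show "c \<in> {\<A>. \<A> \<subseteq> Pow A \<and> |\<A>| \<le>o k}" using x(2) by simp
  qed
  ultimately have gC: "|g ` ?C| \<le>o ctwo ^c k" by (rule card_of_subset_le[rotated])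
  have "?C = (\<Union>c\<in>g ` ?C. {y \<in> ?C. g y = c})" by blast
  moreover have "|\<Union>c\<in>g ` ?C. {y \<in> ?C. g y = c}| \<le>o ctwo ^c k"
    by (rule UNION_Cinfinite_bound[OF gC _ inf2]) (simp add: fibre)
  ultimately show ?thesis by simp
qed

section \<open>The closing-off argument\<close>

text \<open>For \<open>Y\<close> the complement of the union of a small family, \<open>D\<close> is the part of \<open>Y\<close> that has to
  be put into the set under construction: few points, yet a \<open>D\<close> with fewer than \<open>l\<close> points is a
  witness that nothing of \<open>Y\<close> has been left out.\<close>

lemma ex_subset_capped_card:
  assumes l: "Card_order l"
  shows "\<exists>D. D \<subseteq> Y \<and> |D| \<le>o l \<and> ( |D| <o l \<longrightarrow> D = Y)"
proof (cases "|Y| <o l")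
  case True
  then show ?thesis by (intro exI[of _ Y]) (simp add: ordLess_imp_ordLeq)
next
  case False
  have F: "|Field l| =o l" by (rule card_of_Field_ordIso[OF l])
  have "l \<le>o |Y|"
    using False ordLess_or_ordLeq[OF card_of_Well_order[of Y] card_order_on_well_order_on[OF l]]
    by simp
  then have "|Field l| \<le>o |Y|" by (rule ordIso_ordLeq_trans[OF F])
  then obtain D where D: "D \<subseteq> Y" "|Field l| =o |D|"
    using internalize_card_of_ordLeq2[of "Field l" Y] by blast
  have "l =o |D|" using ordIso_transitive[OF ordIso_symmetric[OF F] D(2)] .
  then have "|D| \<le>o l" "\<not> |D| <o l"
    by (auto simp: ordIso_iff_ordLeq dest: not_ordLess_ordLeq)
  with D show ?thesis by blast
qed

text \<open>Of the threshold \<open>l\<close> only \<open>l \<le> 2\<^sup>k\<close> matters: the witnesses that the construction adds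
  for its at most \<open>2\<^sup>k\<close> small families have size at most \<open>l\<close>, so the result stays within
  \<open>2\<^sup>k\<close>.\<close>

theorem Hausdorff_card_le_ctwo_cexp:
  fixes X :: "'a topology" and k :: "'k rel" and l :: "'l rel"
  assumes X: "Hausdorff_space X" and k: "Cinfinite k" and l: "Card_order l" "l \<le>o ctwo ^c k"
    and psi: "\<And>x. x \<in> topspace X \<Longrightarrow>
      \<exists>\<U>. \<U> \<subseteq> {U. openin X U} \<and> |\<U>| \<le>o k \<and> \<Inter>\<U> = {x}"
    and tight: "\<And>A x. A \<subseteq> topspace X \<Longrightarrow> x \<in> X closure_of A \<Longrightarrow>
      \<exists>B. B \<subseteq> A \<and> |B| \<le>o k \<and> x \<in> X closure_of B"
    and cover: "\<And>\<C>. \<C> \<subseteq> {U. openin X U} \<Longrightarrow> \<Union>\<C> = topspace X \<Longrightarrow>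
      \<exists>\<V>. \<V> \<subseteq> \<C> \<and> |\<V>| \<le>o k \<and> |topspace X - \<Union>\<V>| <o l"
  shows "|topspace X| \<le>o ctwo ^c k"
proof -
  have K: "Card_order k" using k by blast
  have inf2: "Cinfinite (ctwo ^c k)" by (rule Cinfinite_ctwo_cexp[OF k])
  have k_le: "k \<le>o ctwo ^c k" by (rule ordLess_imp_ordLeq[OF ordLess_ctwo_cexp[OF K]])
  from bchoice[OF ballI, OF psi] obtain u where "\<forall>x\<in>topspace X.
      u x \<subseteq> {U. openin X U} \<and> |u x| \<le>o k \<and> \<Inter>(u x) = {x}"
    by (rule exE)
  note u = bspec[OF this]
  have "\<forall>Y :: 'a set. \<exists>D. D \<subseteq> Y \<and> |D| \<le>o l \<and> ( |D| <o l \<longrightarrow> D = Y)"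
    by (intro allI ex_subset_capped_card[OF l(1)])
  from choice[OF this] obtain D
    where "\<forall>Y :: 'a set. D Y \<subseteq> Y \<and> |D Y| \<le>o l \<and> ( |D Y| <o l \<longrightarrow> D Y = Y)"
    by (rule exE)
  note D = spec[OF this]
  have closure_le: "|X closure_of A| \<le>o ctwo ^c k" if "|A| \<le>o k" for A
  proof (rule card_closure_le[OF k that])
    fix x assume x: "x \<in> topspace X"
    show "\<exists>\<N>. \<N> \<subseteq> {W. openin X W \<and> x \<in> W} \<and> |\<N>| \<le>o k \<and>
        |{z \<in> topspace X. \<forall>W\<in>\<N>. z \<in> X closure_of W}| \<le>o ctwo ^c k"
      using u[OF x]
      by (intro small_intersection_of_closures[where \<U> = "u x", OF X k l(2) x _ _ _ cover])
        simp_all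
  qed
  \<comment> \<open>A set closed under \<open>\<phi>\<close> is closed in \<open>X\<close> by tightness, and it contains the witnesses for
    all small families of pseudo-base members at its points, because such a family already comes
    from a small set of points.\<close>
  define \<phi> where "\<phi> B = X closure_of B \<union>
    (\<Union>\<V>\<in>Pow (\<Union>(u ` B)). D (topspace X - \<Union>\<V>))" for B
  have \<phi>: "\<phi> B \<subseteq> topspace X \<and> |\<phi> B| \<le>o ctwo ^c k" if B: "B \<subseteq> topspace X" "|B| \<le>o k" for B
  proof
    show "\<phi> B \<subseteq> topspace X"
      unfolding \<phi>_def
      by (intro Un_least UN_least closure_of_subset_topspace
          subset_trans[OF conjunct1[OF D] Diff_subset])
    have U: "|\<Union>(u ` B)| \<le>o k"
      by (rule UNION_Cinfinite_bound[OF B(2) _ k]) (use u B(1) in auto)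
    have "Pow (\<Union>(u ` B)) = {\<V>. \<V> \<subseteq> \<Union>(u ` B) \<and> |\<V>| \<le>o k}"
      using card_of_subset_le[OF _ U] by auto
    then have "|Pow (\<Union>(u ` B))| \<le>o ctwo ^c k"
      using card_bounded_subsets_le[OF k ordLeq_transitive[OF U k_le]] by simp
    moreover have "|D Y| \<le>o ctwo ^c k" for Y
      by (rule ordLeq_transitive[OF _ l(2)]) (simp add: D)
    ultimately have "|\<Union>\<V>\<in>Pow (\<Union>(u ` B)). D (topspace X - \<Union>\<V>)| \<le>o ctwo ^c k"
      by (intro UNION_Cinfinite_bound[OF _ _ inf2]) simp_all
    then show "|\<phi> B| \<le>o ctwo ^c k"
      unfolding \<phi>_def by (rule Un_Cinfinite_bound[OF closure_le[OF B(2)] _ inf2])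
  qed
  have "\<exists>F. F \<subseteq> topspace X \<and> |F| \<le>o ctwo ^c k \<and>
      (\<forall>B. B \<subseteq> F \<longrightarrow> |B| \<le>o k \<longrightarrow> \<phi> B \<subseteq> F)"
    by (rule closing_off[OF k \<phi>])
  then obtain F where F: "F \<subseteq> topspace X" "|F| \<le>o ctwo ^c k"
    "\<And>B. B \<subseteq> F \<Longrightarrow> |B| \<le>o k \<Longrightarrow> \<phi> B \<subseteq> F"
    by auto
  have "X closure_of F \<subseteq> F"
  proof
    fix x assume "x \<in> X closure_of F"
    then obtain B where "B \<subseteq> F" "|B| \<le>o k" "x \<in> X closure_of B" using tight F(1) by blast
    then show "x \<in> F" using F(3)[of B] unfolding \<phi>_def by blast
  qed
  then have "closedin X F"
    using F(1) closure_of_subset[OF F(1)] closedin_closure_of[of X F] by (simp add: subset_antisym)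
  then have openF: "openin X (topspace X - F)" by blast
  have "topspace X \<subseteq> F"
  proof (rule ccontr)
    assume "\<not> topspace X \<subseteq> F"
    then obtain y where y: "y \<in> topspace X" "y \<notin> F" by blast
    have uF: "u x \<subseteq> {U. openin X U}" "\<Inter>(u x) = {x}" if "x \<in> F" for x
      using u[OF subsetD[OF F(1) that]] by simp_all
    have "\<forall>x\<in>F. \<exists>U. U \<in> u x \<and> y \<notin> U"
    proof
      fix x assume x: "x \<in> F"
      have "y \<noteq> x" using x y(2) by blast
      then show "\<exists>U. U \<in> u x \<and> y \<notin> U" using uF(2)[OF x] by blast
    qed
    from bchoice[OF this] obtain f where "\<forall>x\<in>F. f x \<in> u x \<and> y \<notin> f x" by (rule exE)
    note f = bspec[OF this]
    have fx: "openin X (f x) \<and> x \<in> f x" if "x \<in> F" for x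
      using f[OF that] uF[OF that] by blast
    let ?\<C> = "insert (topspace X - F) (f ` F)"
    have "f x \<subseteq> topspace X" if "x \<in> F" for x
      by (rule openin_subset) (simp add: fx[OF that])
    then have "\<Union>?\<C> \<subseteq> topspace X" by auto
    moreover have "topspace X \<subseteq> \<Union>?\<C>" using fx by auto
    ultimately have "\<Union>?\<C> = topspace X" by (rule subset_antisym)
    moreover have "?\<C> \<subseteq> {U. openin X U}" using fx openF by auto
    ultimately have "\<exists>\<V>. \<V> \<subseteq> ?\<C> \<and> |\<V>| \<le>o k \<and> |topspace X - \<Union>\<V>| <o l"
      by (intro cover)
    then obtain \<V>' where \<V>': "\<V>' \<subseteq> ?\<C>" "|\<V>'| \<le>o k" "|topspace X - \<Union>\<V>'| <o l"
      by (elim exE conjE)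
    \<comment> \<open>Injectivity of \<open>f\<close> on \<open>B\<close> keeps \<open>B\<close> as small as the family that it indexes.\<close>
    obtain B where B: "B \<subseteq> F" "inj_on f B" "\<V>' \<inter> f ` F = f ` B"
      using iffD1[OF subset_image_inj, of "\<V>' \<inter> f ` F" f F] by auto
    have "|f ` B| \<le>o k"
      by (rule card_of_subset_le[OF _ \<V>'(2)]) (simp flip: B(3))
    moreover have "|B| =o |f ` B|"
      by (rule card_of_ordIsoI[of f]) (simp add: bij_betw_def B(2))
    ultimately have Bk: "|B| \<le>o k" by (rule ordIso_ordLeq_trans[rotated])
    let ?Y = "topspace X - \<Union>(f ` B)"
    have "f ` B \<in> Pow (\<Union>(u ` B))" using f subsetD[OF B(1)] by auto
    then have "D ?Y \<subseteq> \<phi> B" unfolding \<phi>_def by (intro le_supI2 UN_upper)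
    then have DF: "D ?Y \<subseteq> F" using F(3)[OF B(1) Bk] by (rule subset_trans)
    \<comment> \<open>The member \<open>topspace X - F\<close> of the cover does not help to cover points of \<open>F\<close>.\<close>
    have "F \<inter> ?Y \<subseteq> topspace X - \<Union>\<V>'"
    proof
      fix z assume z: "z \<in> F \<inter> ?Y"
      have "z \<notin> V" if V: "V \<in> \<V>'" for V
      proof (cases "V \<in> f ` F")
        case True
        then have "V \<in> f ` B" using V B(3) by blast
        then show ?thesis using z by blast
      next
        case False
        then have "V = topspace X - F" using subsetD[OF \<V>'(1) V] by simp
        then show ?thesis using z by simp
      qed
      then show "z \<in> topspace X - \<Union>\<V>'" using z by simp
    qed
    moreover have "D ?Y \<subseteq> F \<inter> ?Y" using DF D[of ?Y] by simp
    ultimately have "D ?Y \<subseteq> topspace X - \<Union>\<V>'" by (rule subset_trans[rotated])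
    then have "|D ?Y| <o l" by (rule ordLeq_ordLess_trans[OF card_of_mono1 \<V>'(3)])
    then have "D ?Y = ?Y" using D[of ?Y] by simp
    moreover have "y \<in> ?Y" using y(1) f subsetD[OF B(1)] by auto
    ultimately show False using subsetD[OF DF, of y] y(2) by simp
  qed
  then show ?thesis by (rule card_of_subset_le[OF _ F(2)])
qed

section \<open>The cardinal functions are infinite cardinals\<close>

text \<open>The definition of a least infinite cardinal is by choice, so it says something only once a
  cardinal with the property is known; each cardinal function of a space is bounded by the size of the type on
  which its values live.\<close>

lemma Cinfinite_least_infinite_cardinal:
  fixes P :: "('a + nat) rel \<Rightarrow> bool"
  assumes "P |UNIV|"
  shows "Cinfinite (least_infinite_cardinal P)"
  using least_infinite_cardinal_ex[of P] Cinfinite_UNIV_point assms by blast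

lemma Cinfinite_pseudo_character:
  fixes X :: "'a topology"
  assumes "t1_space X"
  shows "Cinfinite (pseudo_character X)"
  unfolding pseudo_character_def
  by (intro Cinfinite_least_infinite_cardinal ballI
      iffD2[OF pseudo_character_at_le_iff[OF assms _ Cinfinite_UNIV_point]] pseudo_base_ex[OF assms])

lemma Cinfinite_tightness:
  fixes X :: "'a topology"
  shows "Cinfinite (tightness X)"
  unfolding tightness_def
proof (intro Cinfinite_least_infinite_cardinal ballI
    iffD2[OF tightness_at_le_iff[OF Cinfinite_UNIV_point]] allI impI)
  fix x A assume "A \<subseteq> topspace X \<and> x \<in> X closure_of A"
  then show "\<exists>B. B \<subseteq> A \<and> |B| \<le>o |UNIV :: ('a + nat) set| \<and> x \<in> X closure_of B"
    by (intro exI[of _ A]) (simp add: card_of_point_le_top)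
qed

lemma Cinfinite_skew_Lindelof_degree:
  fixes X :: "'a topology"
  assumes l: "Cinfinite l"
  shows "Cinfinite (skew_Lindelof_degree X l)"
  unfolding skew_Lindelof_degree_def
proof (intro Cinfinite_least_infinite_cardinal allI impI)
  fix \<U> assume \<U>: "\<U> \<subseteq> {U. openin X U} \<and> \<Union>\<U> = topspace X"
  then have "\<forall>x\<in>topspace X. \<exists>U. U \<in> \<U> \<and> x \<in> U" by blast
  from bchoice[OF this] obtain f where f: "\<forall>x\<in>topspace X. f x \<in> \<U> \<and> x \<in> f x" by (rule exE)
  have "|f ` topspace X| \<le>o |UNIV :: ('a + nat) set|"
    by (rule ordLeq_transitive[OF card_of_image card_of_point_le_top])
  moreover have "|topspace X - \<Union>(f ` topspace X)| <o l"
  proof (rule card_of_finite_less[OF _ l])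
    have "topspace X - \<Union>(f ` topspace X) = {}" using f by blast
    then show "finite (topspace X - \<Union>(f ` topspace X))" by (simp only: finite.emptyI)
  qed
  ultimately show "\<exists>\<V>\<subseteq>\<U>. |\<V>| \<le>o |UNIV :: ('a + nat) set| \<and> |topspace X - \<Union>\<V>| <o l"
    using f by (intro exI[of _ "f ` topspace X"]) (simp add: image_subset_iff)
qed

section \<open>The cardinality bound\<close>

theorem theorem3p8:
  fixes X :: "'a topology"
  assumes "Hausdorff_space X"
  shows "|topspace X| \<le>o
    ctwo ^c (skew_Lindelof_degree X (ctwo ^c (pseudo_character X *c tightness X))
      *c pseudo_character X *c tightness X)"
proof -
  let ?pt = "pseudo_character X *c tightness X"
  let ?l = "ctwo ^c ?pt"
  let ?L = "skew_Lindelof_degree X ?l"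
  let ?k = "?L *c ?pt"
  have t1: "t1_space X" by (rule Hausdorff_imp_t1_space[OF assms])
  have p: "Cinfinite (pseudo_character X)" by (rule Cinfinite_pseudo_character[OF t1])
  have t: "Cinfinite (tightness X)" by (rule Cinfinite_tightness)
  have pt: "Cinfinite ?pt" by (rule Cinfinite_cprod2[OF Cinfinite_Cnotzero[OF p] t])
  have l: "Cinfinite ?l" by (rule Cinfinite_ctwo_cexp[OF pt])
  have L: "Cinfinite ?L" by (rule Cinfinite_skew_Lindelof_degree[OF l])
  have k: "Cinfinite ?k" by (rule Cinfinite_cprod2[OF Cinfinite_Cnotzero[OF L] pt])
  have pt_k: "?pt \<le>o ?k" using ordLeq_cprod2 Cinfinite_Cnotzero L pt by blast
  have p_k: "pseudo_character X \<le>o ?k"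
    using ordLeq_transitive[OF ordLeq_cprod1 pt_k] p Cinfinite_Cnotzero[OF t] by blast
  have t_k: "tightness X \<le>o ?k"
    using ordLeq_transitive[OF ordLeq_cprod2 pt_k] t Cinfinite_Cnotzero[OF p] by blast
  have L_k: "?L \<le>o ?k" using ordLeq_cprod1 L Cinfinite_Cnotzero[OF pt] by blast
  have l_k: "?l \<le>o ctwo ^c ?k"
    by (rule cexp_mono2_Cnotzero[OF pt_k Card_order_ctwo Cinfinite_Cnotzero[OF pt]])
  show ?thesis
  proof (rule Hausdorff_card_le_ctwo_cexp[OF assms k _ l_k])
    show "Card_order ?l" using l by blast
  next
    fix x assume "x \<in> topspace X"
    then show "\<exists>\<U>. \<U> \<subseteq> {U. openin X U} \<and> |\<U>| \<le>o ?k \<and> \<Inter>\<U> = {x}"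
      using iffD1[OF pseudo_character_le_iff[OF t1 k] p_k] by blast
  next
    fix A x assume "A \<subseteq> topspace X" "x \<in> X closure_of A"
    then show "\<exists>B. B \<subseteq> A \<and> |B| \<le>o ?k \<and> x \<in> X closure_of B"
      using iffD1[OF tightness_le_iff[OF k] t_k] closure_of_subset_topspace[of X A] by blast
  next
    fix \<C> assume "\<C> \<subseteq> {U. openin X U}" "\<Union>\<C> = topspace X"
    then show "\<exists>\<V>. \<V> \<subseteq> \<C> \<and> |\<V>| \<le>o ?k \<and> |topspace X - \<Union>\<V>| <o ?l"
      using iffD1[OF skew_Lindelof_degree_le_iff[OF l k] L_k] by blast
  qed
qed

end
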